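(* Let $g,b,z_d\in\mathbb{R}$, $M_2>0$ and $\alpha>0$. Let $u_{\alpha q_{\alpha_{op}}}$ be the solution of $(S_\alpha)$ for $q=q_{\alpha_{op}}$, the minimizer of $J_{2\alpha}$ over $\mathbb{R}$, and for $h=x_0/n$ let $u^h_{\alpha q^h_{\alpha_{op}}}$ be the discrete solution for $q=q^h_{\alpha_{op}}$, the minimizer of $J^h_{2\alpha}$ over $\mathbb{R}$. Then there are constants $C_{10\alpha},C_{11\alpha}$ independent of $h$ such that, as $h\to0$ ($h=x_0/n$, $n\to\infty$), $$\text{(a)}\quad\|u^h_{\alpha q^h_{\alpha_{op}}}-u_{\alpha q_{\alpha_{op}}}\|_H=C_{10\alpha}h+o(h),\qquad\text{(b)}\quad\left\|\frac{\partial u^h_{\alpha q^h_{\alpha_{op}}}}{\partial x}-\frac{\partial u_{\alpha q_{\alpha_{op}}}}{\partial x}\right\|_H=C_{11\alpha}h+o(h).$$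
   Context: Fix $x_0,y_0>0$, $\Omega=(0,x_0)\times(0,y_0)$, $\Gamma_2=\{x_0\}\times(0,y_0]$, $H=L^2(\Omega)$, $Q=L^2(\Gamma_2)$ with their standard norms. For constants $g,q,b\in\mathbb{R}$ and $\alpha>0$, system $(S_\alpha)$: $-\Delta u=g$ in $\Omega$, $-\partial u/\partial n=\alpha(u-b)$ on $\{0\}\times(0,y_0]$, $-\partial u/\partial n=q$ on $\Gamma_2$, $-\partial u/\partial n=0$ on $[0,x_0]\times\{0,y_0\}$, has solution $u_{\alpha q}(x,y)=-\tfrac12gx^2+(gx_0-q)x+\tfrac1\alpha(gx_0-q)+b$. For an integer $n\ge1$, $h=x_0/n$, $x_i=(i-1)h$, its discrete (finite-difference, piecewise linear) approximation is $u^h_{\alpha q}(x,y)=(gx_0-q-hgi)x+b+\tfrac{gx_0-q}\alpha-\tfrac{gh}\alpha+\tfrac{i^2-i}2gh^2$ for $x\in[x_i,x_{i+1}]$, $y\in[0,y_0]$, $i=1,\dots,n$ (its $x$-derivative is piecewise constant, defined a.e.). For fixed $g,b,z_d\in\mathbb{R}$ and $M_2>0$ the cost functions on $\mathbb{R}$ are $J_{2\alpha}(q)=\tfrac12\|u_{\alpha q}-z_d\|_H^2+\tfrac{M_2}2\|q\|_Q^2$ and $J^h_{2\alpha}(q)=\tfrac12\|u^h_{\alpha q}-z_d\|_H^2+\tfrac{M_2}2\|q\|_Q^2$, where $\|q\|_Q^2=y_0q^2$ for constant $q$. *)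

theory Defs
  imports "HOL-Analysis.Analysis" "HOL-Library.Landau_Symbols"
begin

definition Omega :: "real \<Rightarrow> real \<Rightarrow> (real \<times> real) set" where
  "Omega x\<^sub>0 y\<^sub>0 = {0<..<x\<^sub>0} \<times> {0<..<y\<^sub>0}"

definition normH :: "real \<Rightarrow> real \<Rightarrow> (real \<times> real \<Rightarrow> real) \<Rightarrow> real" where
  "normH x\<^sub>0 y\<^sub>0 f = sqrt (LINT p : Omega x\<^sub>0 y\<^sub>0 | lebesgue. (f p)\<^sup>2)"

(* The norm of L^2 of the segment {x0} x (0,y0], parametrised by y (its arc length). *)
definition normQ :: "real \<Rightarrow> real \<Rightarrow> (real \<times> real \<Rightarrow> real) \<Rightarrow> real" where
  "normQ x\<^sub>0 y\<^sub>0 f = sqrt (LINT y : {0<..y\<^sub>0} | lebesgue. (f (x\<^sub>0, y))\<^sup>2)"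

definition partial_x :: "(real \<times> real \<Rightarrow> real) \<Rightarrow> real \<times> real \<Rightarrow> real" where
  "partial_x f = (\<lambda>(x, y). deriv (\<lambda>s. f (s, y)) x)"

(* u is a solution of  - Laplace u = g  in Omega with
     - du/dn = alpha (u - b)  on {0} x (0,y0],
     - du/dn = q              on {x0} x (0,y0],
     - du/dn = 0              on [0,x0] x {0,y0},
   in the classical sense: u and its unmixed partial derivatives ux, uy, uxx, uyy exist
   and are continuous on the closed rectangle (one-sided derivatives on the boundary).
   The outward normals on the four sides are (-1,0), (1,0), (0,-1), (0,1), so that
   - du/dn equals ux, - ux, uy, - uy there, respectively.  Values of u outside the closed
   rectangle are irrelevant. *)
definition solves_S ::
    "real \<Rightarrow> real \<Rightarrow> real \<Rightarrow> real \<Rightarrow> real \<Rightarrow> real \<Rightarrow> (real \<times> real \<Rightarrow> real) \<Rightarrow> bool" where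
  "solves_S x\<^sub>0 y\<^sub>0 g b \<alpha> q u \<longleftrightarrow>
     (\<exists>ux uy uxx uyy.
        (\<forall>f \<in> {u, ux, uy, uxx, uyy}. continuous_on ({0..x\<^sub>0} \<times> {0..y\<^sub>0}) f) \<and>
        (\<forall>x \<in> {0..x\<^sub>0}. \<forall>y \<in> {0..y\<^sub>0}.
           ((\<lambda>s. u (s, y)) has_real_derivative ux (x, y)) (at x within {0..x\<^sub>0}) \<and>
           ((\<lambda>s. ux (s, y)) has_real_derivative uxx (x, y)) (at x within {0..x\<^sub>0}) \<and>
           ((\<lambda>t. u (x, t)) has_real_derivative uy (x, y)) (at y within {0..y\<^sub>0}) \<and>
           ((\<lambda>t. uy (x, t)) has_real_derivative uyy (x, y)) (at y within {0..y\<^sub>0})) \<and>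
        (\<forall>p \<in> Omega x\<^sub>0 y\<^sub>0. - (uxx p + uyy p) = g) \<and>
        (\<forall>y \<in> {0<..y\<^sub>0}. ux (0, y) = \<alpha> * (u (0, y) - b)) \<and>
        (\<forall>y \<in> {0<..y\<^sub>0}. - ux (x\<^sub>0, y) = q) \<and>
        (\<forall>x \<in> {0..x\<^sub>0}. uy (x, 0) = 0 \<and> - uy (x, y\<^sub>0) = 0))"

definition u_sol :: "real \<Rightarrow> real \<Rightarrow> real \<Rightarrow> real \<Rightarrow> real \<Rightarrow> real \<times> real \<Rightarrow> real" where
  "u_sol x\<^sub>0 g b \<alpha> q =
     (\<lambda>(x, y). - (1/2) * g * x\<^sup>2 + (g * x\<^sub>0 - q) * x + (1/\<alpha>) * (g * x\<^sub>0 - q) + b)"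

lemma u_sol_solves_S:
  assumes "\<alpha> > 0"
  shows "solves_S x\<^sub>0 y\<^sub>0 g b \<alpha> q (u_sol x\<^sub>0 g b \<alpha> q)"
proof -
  let ?ux = "\<lambda>p. - g * fst p + (g * x\<^sub>0 - q)"
  have u: "u_sol x\<^sub>0 g b \<alpha> q =
      (\<lambda>p. - (1/2) * g * (fst p)\<^sup>2 + (g * x\<^sub>0 - q) * fst p + (1/\<alpha>) * (g * x\<^sub>0 - q) + b)"
    by (auto simp: u_sol_def)
  have cont: "continuous_on ({0..x\<^sub>0} \<times> {0..y\<^sub>0}) (u_sol x\<^sub>0 g b \<alpha> q)"
    unfolding u by (intro continuous_intros)
  have ux: "((\<lambda>s. u_sol x\<^sub>0 g b \<alpha> q (s, y)) has_real_derivative ?ux (x, y)) (at x within {0..x\<^sub>0})" for x y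
    unfolding u by (auto intro!: derivative_eq_intros)
  have uxx: "((\<lambda>s. ?ux (s, y)) has_real_derivative - g) (at x within {0..x\<^sub>0})" for x y
    by (auto intro!: derivative_eq_intros)
  have uy: "((\<lambda>t. u_sol x\<^sub>0 g b \<alpha> q (x, t)) has_real_derivative 0) (at y within {0..y\<^sub>0})" for x y
    unfolding u by simp
  show ?thesis
    unfolding solves_S_def
  proof (intro exI conjI ballI)
    fix f assume "f \<in> {u_sol x\<^sub>0 g b \<alpha> q, ?ux, \<lambda>_. 0, \<lambda>_. - g, \<lambda>_. 0}"
    moreover have "continuous_on ({0..x\<^sub>0} \<times> {0..y\<^sub>0}) ?ux" by (intro continuous_intros)
    ultimately show "continuous_on ({0..x\<^sub>0} \<times> {0..y\<^sub>0}) f" using cont by auto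
  qed (use assms ux uxx uy in \<open>simp_all add: u_sol_def\<close>)
qed

lemma solves_S_homogeneous_zero:
  assumes pos: "x\<^sub>0 > 0" "y\<^sub>0 > 0" "\<alpha> > 0" and w: "solves_S x\<^sub>0 y\<^sub>0 0 0 \<alpha> 0 w"
    and p: "p \<in> {0..x\<^sub>0} \<times> {0..y\<^sub>0}"
  shows "w p = 0"
proof -
  obtain wx wy wxx wyy where
    c: "\<forall>f \<in> {w, wx, wy, wxx, wyy}. continuous_on ({0..x\<^sub>0} \<times> {0..y\<^sub>0}) f"
    and d: "\<forall>x \<in> {0..x\<^sub>0}. \<forall>y \<in> {0..y\<^sub>0}.
           ((\<lambda>s. w (s, y)) has_real_derivative wx (x, y)) (at x within {0..x\<^sub>0}) \<and>
           ((\<lambda>s. wx (s, y)) has_real_derivative wxx (x, y)) (at x within {0..x\<^sub>0}) \<and>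
           ((\<lambda>t. w (x, t)) has_real_derivative wy (x, y)) (at y within {0..y\<^sub>0}) \<and>
           ((\<lambda>t. wy (x, t)) has_real_derivative wyy (x, y)) (at y within {0..y\<^sub>0})"
    and lap: "\<forall>p \<in> Omega x\<^sub>0 y\<^sub>0. - (wxx p + wyy p) = 0"
    and b1: "\<forall>y \<in> {0<..y\<^sub>0}. wx (0, y) = \<alpha> * (w (0, y) - 0)"
    and b2: "\<forall>y \<in> {0<..y\<^sub>0}. - wx (x\<^sub>0, y) = 0"
    and b3: "\<forall>x \<in> {0..x\<^sub>0}. wy (x, 0) = 0 \<and> - wy (x, y\<^sub>0) = 0"
    using w unfolding solves_S_def by blast
  note d = d[rule_format]
  have lap: "wxx p + wyy p = 0" if "p \<in> Omega x\<^sub>0 y\<^sub>0" for p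
    using lap that by (metis neg_equal_0_iff_equal)
  have b1: "wx (0, y) = \<alpha> * w (0, y)" if "y \<in> {0<..y\<^sub>0}" for y using b1 that by simp
  have b2: "wx (x\<^sub>0, y) = 0" if "y \<in> {0<..y\<^sub>0}" for y using b2 that by simp
  have b3: "wy (x, 0) = 0" "wy (x, y\<^sub>0) = 0" if "x \<in> {0..x\<^sub>0}" for x using b3 that by auto
  have c': "continuous_on ({0..x\<^sub>0} \<times> {0..y\<^sub>0}) w" "continuous_on ({0..x\<^sub>0} \<times> {0..y\<^sub>0}) wx"
    "continuous_on ({0..x\<^sub>0} \<times> {0..y\<^sub>0}) wy" "continuous_on ({0..x\<^sub>0} \<times> {0..y\<^sub>0}) wxx"
    "continuous_on ({0..x\<^sub>0} \<times> {0..y\<^sub>0}) wyy"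
    using c by auto
  have box: "cbox (0, 0) (x\<^sub>0, y\<^sub>0) = {0..x\<^sub>0} \<times> {0..y\<^sub>0}"
    by (simp add: cbox_Pair_eq)
  have box': "box (0, 0) (x\<^sub>0, y\<^sub>0) = Omega x\<^sub>0 y\<^sub>0"
    unfolding Omega_def by (auto simp: mem_box Basis_prod_def)
  have ne: "Omega x\<^sub>0 y\<^sub>0 \<noteq> {}" using pos by (auto simp: Omega_def)
  define A where "A = (\<lambda>p. (wx p)\<^sup>2 + w p * wxx p)"
  define B where "B = (\<lambda>p. (wy p)\<^sup>2 + w p * wyy p)"
  define E where "E = (\<lambda>p. (wx p)\<^sup>2 + (wy p)\<^sup>2)"
  have cA: "continuous_on (cbox (0, 0) (x\<^sub>0, y\<^sub>0)) A"
    and cB: "continuous_on (cbox (0, 0) (x\<^sub>0, y\<^sub>0)) B"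
    and cE: "continuous_on (cbox (0, 0) (x\<^sub>0, y\<^sub>0)) E"
    unfolding A_def B_def E_def box by (intro continuous_intros c')+
  have intA: "integral {0..x\<^sub>0} (\<lambda>x. A (x, y)) = - \<alpha> * (w (0, y))\<^sup>2" if y: "y \<in> {0<..y\<^sub>0}" for y
  proof -
    have "((\<lambda>x. A (x, y)) has_integral
        (w (x\<^sub>0, y) * wx (x\<^sub>0, y) - w (0, y) * wx (0, y))) {0..x\<^sub>0}"
    proof (rule fundamental_theorem_of_calculus)
      fix x assume x: "x \<in> {0..x\<^sub>0}"
      have "((\<lambda>x. w (x, y) * wx (x, y)) has_real_derivative A (x, y)) (at x within {0..x\<^sub>0})"
        unfolding A_def using d[of x y] x y
        by (auto intro!: derivative_eq_intros simp: power2_eq_square)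
      then show "((\<lambda>x. w (x, y) * wx (x, y)) has_vector_derivative A (x, y)) (at x within {0..x\<^sub>0})"
        by (simp add: has_real_derivative_iff_has_vector_derivative)
    qed (use pos in auto)
    then show ?thesis using b1[OF y] b2[OF y] by (simp add: integral_unique power2_eq_square)
  qed
  have intB: "integral {0..y\<^sub>0} (\<lambda>y. B (x, y)) = 0" if x: "x \<in> {0..x\<^sub>0}" for x
  proof -
    have "((\<lambda>y. B (x, y)) has_integral
        (w (x, y\<^sub>0) * wy (x, y\<^sub>0) - w (x, 0) * wy (x, 0))) {0..y\<^sub>0}"
    proof (rule fundamental_theorem_of_calculus)
      fix y assume y: "y \<in> {0..y\<^sub>0}"
      have "((\<lambda>y. w (x, y) * wy (x, y)) has_real_derivative B (x, y)) (at y within {0..y\<^sub>0})"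
        unfolding B_def using d[of x y] x y
        by (auto intro!: derivative_eq_intros simp: power2_eq_square)
      then show "((\<lambda>y. w (x, y) * wy (x, y)) has_vector_derivative B (x, y)) (at y within {0..y\<^sub>0})"
        by (simp add: has_real_derivative_iff_has_vector_derivative)
    qed (use pos in auto)
    then show ?thesis using b3[OF x] by (simp add: integral_unique)
  qed
  have cw0: "continuous_on {0..y\<^sub>0} (\<lambda>y. (w (0, y))\<^sup>2)"
    by (intro continuous_intros continuous_on_compose2[OF c'(1)]) (use pos in auto)
  have IA: "integral (cbox (0, 0) (x\<^sub>0, y\<^sub>0)) A = - \<alpha> * integral {0..y\<^sub>0} (\<lambda>y. (w (0, y))\<^sup>2)"
  proof -
    have "integral (cbox (0, 0) (x\<^sub>0, y\<^sub>0)) A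
        = integral {0..y\<^sub>0} (\<lambda>y. integral {0..x\<^sub>0} (\<lambda>x. A (x, y)))"
      using integral_prod_continuous[OF cA] integral_swap_continuous[of 0 0 x\<^sub>0 y\<^sub>0 "curry A"] cA
      by (simp add: curry_def case_prod_beta)
    also have "\<dots> = integral {0..y\<^sub>0} (\<lambda>y. - \<alpha> * (w (0, y))\<^sup>2)"
      by (rule integral_spike[of "{0}"]) (auto simp: intA)
    finally show ?thesis by simp
  qed
  have IB: "integral (cbox (0, 0) (x\<^sub>0, y\<^sub>0)) B = 0"
  proof -
    have "integral (cbox (0, 0) (x\<^sub>0, y\<^sub>0)) B
        = integral {0..x\<^sub>0} (\<lambda>x. integral {0..y\<^sub>0} (\<lambda>y. B (x, y)))"
      using integral_prod_continuous[OF cB] by simp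
    also have "\<dots> = integral {0..x\<^sub>0} (\<lambda>x. 0)"
      by (rule integral_cong) (auto simp: intB)
    finally show ?thesis by simp
  qed
  have "integral (cbox (0, 0) (x\<^sub>0, y\<^sub>0)) E = integral (cbox (0, 0) (x\<^sub>0, y\<^sub>0)) (\<lambda>p. A p + B p)"
  proof (rule integral_spike)
    show "negligible (cbox (0, 0) (x\<^sub>0, y\<^sub>0) - box (0, 0) (x\<^sub>0, y\<^sub>0))"
      by (rule negligible_frontier_interval)
    fix p assume "p \<in> cbox (0, 0) (x\<^sub>0, y\<^sub>0) - (cbox (0, 0) (x\<^sub>0, y\<^sub>0) - box (0, 0) (x\<^sub>0, y\<^sub>0))"
    then have "wxx p + wyy p = 0" using lap box' by auto
    then have "w p * (wxx p + wyy p) = 0" by simp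
    then show "A p + B p = E p" unfolding A_def B_def E_def by (simp add: algebra_simps)
  qed
  also have "\<dots> = - \<alpha> * integral {0..y\<^sub>0} (\<lambda>y. (w (0, y))\<^sup>2)"
    using integral_add[OF integrable_continuous[OF cA] integrable_continuous[OF cB]] IA IB by simp
  finally have IE: "integral (cbox (0, 0) (x\<^sub>0, y\<^sub>0)) E = - \<alpha> * integral {0..y\<^sub>0} (\<lambda>y. (w (0, y))\<^sup>2)" .
  moreover have "integral (cbox (0, 0) (x\<^sub>0, y\<^sub>0)) E \<ge> 0"
    by (rule integral_nonneg[OF integrable_continuous[OF cE]]) (simp add: E_def)
  moreover have nn: "integral {0..y\<^sub>0} (\<lambda>y. (w (0, y))\<^sup>2) \<ge> 0"
    by (rule integral_nonneg[OF integrable_continuous_interval[OF cw0]]) simp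
  ultimately have "\<alpha> * integral {0..y\<^sub>0} (\<lambda>y. (w (0, y))\<^sup>2) \<le> 0" by linarith
  with nn pos have W0: "integral {0..y\<^sub>0} (\<lambda>y. (w (0, y))\<^sup>2) = 0"
    by (simp add: mult_le_0_iff)
  with IE have E0: "integral (cbox (0, 0) (x\<^sub>0, y\<^sub>0)) E = 0" by simp
  have Ez: "E p = 0" if "p \<in> cbox (0, 0) (x\<^sub>0, y\<^sub>0)" for p
    by (rule has_integral_0_cbox_imp_0[OF cE _ _ _ that])
      (use E0 ne box' integrable_integral[OF integrable_continuous[OF cE]] in \<open>auto simp: E_def\<close>)
  have w0: "w (0, y) = 0" if "y \<in> {0..y\<^sub>0}" for y
  proof -
    have "(w (0, y))\<^sup>2 = 0"
      by (rule has_integral_0_cbox_imp_0[of 0 y\<^sub>0 "\<lambda>y. (w (0, y))\<^sup>2"])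
        (use W0 cw0 integrable_integral[OF integrable_continuous_interval[OF cw0]] pos that in auto)
    then show ?thesis by simp
  qed
  obtain x y where xy: "p = (x, y)" "x \<in> {0..x\<^sub>0}" "y \<in> {0..y\<^sub>0}" using p by auto
  have "\<exists>k. \<forall>s \<in> {0..x\<^sub>0}. w (s, y) = k"
  proof (rule has_field_derivative_zero_constant)
    fix s assume s: "s \<in> {0..x\<^sub>0}"
    have "wx (s, y) = 0" using Ez[of "(s, y)"] s xy unfolding box E_def by (auto simp: sum_power2_eq_zero_iff)
    then show "((\<lambda>s. w (s, y)) has_real_derivative 0) (at s within {0..x\<^sub>0})"
      using d[OF s xy(3)] by simp
  qed simp
  then show ?thesis using w0[OF xy(3)] xy pos by (metis atLeastAtMost_iff order_refl less_imp_le)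
qed

theorem solves_S_unique:
  assumes pos: "x\<^sub>0 > 0" "y\<^sub>0 > 0" "\<alpha> > 0" and u: "solves_S x\<^sub>0 y\<^sub>0 g b \<alpha> q u"
    and p: "p \<in> {0..x\<^sub>0} \<times> {0..y\<^sub>0}"
  shows "u p = u_sol x\<^sub>0 g b \<alpha> q p"
proof -
  define v where "v = u_sol x\<^sub>0 g b \<alpha> q"
  have v: "solves_S x\<^sub>0 y\<^sub>0 g b \<alpha> q v" unfolding v_def by (rule u_sol_solves_S[OF pos(3)])
  obtain ux uy uxx uyy where U:
    "\<forall>f \<in> {u, ux, uy, uxx, uyy}. continuous_on ({0..x\<^sub>0} \<times> {0..y\<^sub>0}) f"
    "\<forall>x \<in> {0..x\<^sub>0}. \<forall>y \<in> {0..y\<^sub>0}.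
           ((\<lambda>s. u (s, y)) has_real_derivative ux (x, y)) (at x within {0..x\<^sub>0}) \<and>
           ((\<lambda>s. ux (s, y)) has_real_derivative uxx (x, y)) (at x within {0..x\<^sub>0}) \<and>
           ((\<lambda>t. u (x, t)) has_real_derivative uy (x, y)) (at y within {0..y\<^sub>0}) \<and>
           ((\<lambda>t. uy (x, t)) has_real_derivative uyy (x, y)) (at y within {0..y\<^sub>0})"
    "\<forall>p \<in> Omega x\<^sub>0 y\<^sub>0. - (uxx p + uyy p) = g"
    "\<forall>y \<in> {0<..y\<^sub>0}. ux (0, y) = \<alpha> * (u (0, y) - b)"
    "\<forall>y \<in> {0<..y\<^sub>0}. - ux (x\<^sub>0, y) = q"
    "\<forall>x \<in> {0..x\<^sub>0}. uy (x, 0) = 0 \<and> - uy (x, y\<^sub>0) = 0"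
    using u unfolding solves_S_def by blast
  obtain vx vy vxx vyy where V:
    "\<forall>f \<in> {v, vx, vy, vxx, vyy}. continuous_on ({0..x\<^sub>0} \<times> {0..y\<^sub>0}) f"
    "\<forall>x \<in> {0..x\<^sub>0}. \<forall>y \<in> {0..y\<^sub>0}.
           ((\<lambda>s. v (s, y)) has_real_derivative vx (x, y)) (at x within {0..x\<^sub>0}) \<and>
           ((\<lambda>s. vx (s, y)) has_real_derivative vxx (x, y)) (at x within {0..x\<^sub>0}) \<and>
           ((\<lambda>t. v (x, t)) has_real_derivative vy (x, y)) (at y within {0..y\<^sub>0}) \<and>
           ((\<lambda>t. vy (x, t)) has_real_derivative vyy (x, y)) (at y within {0..y\<^sub>0})"
    "\<forall>p \<in> Omega x\<^sub>0 y\<^sub>0. - (vxx p + vyy p) = g"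
    "\<forall>y \<in> {0<..y\<^sub>0}. vx (0, y) = \<alpha> * (v (0, y) - b)"
    "\<forall>y \<in> {0<..y\<^sub>0}. - vx (x\<^sub>0, y) = q"
    "\<forall>x \<in> {0..x\<^sub>0}. vy (x, 0) = 0 \<and> - vy (x, y\<^sub>0) = 0"
    using v unfolding solves_S_def by blast
  have "solves_S x\<^sub>0 y\<^sub>0 0 0 \<alpha> 0 (\<lambda>p. u p - v p)"
    unfolding solves_S_def
  proof (intro exI conjI)
    show "\<forall>f \<in> {\<lambda>p. u p - v p, \<lambda>p. ux p - vx p, \<lambda>p. uy p - vy p,
        \<lambda>p. uxx p - vxx p, \<lambda>p. uyy p - vyy p}. continuous_on ({0..x\<^sub>0} \<times> {0..y\<^sub>0}) f"
      using U(1) V(1) by (auto intro!: continuous_intros)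
    show "\<forall>p \<in> Omega x\<^sub>0 y\<^sub>0. - (uxx p - vxx p + (uyy p - vyy p)) = 0"
      using U(3) V(3) by (fastforce simp: algebra_simps)
    show "\<forall>y \<in> {0<..y\<^sub>0}. ux (0, y) - vx (0, y) = \<alpha> * (u (0, y) - v (0, y) - 0)"
    proof
      fix y assume "y \<in> {0<..y\<^sub>0}"
      then show "ux (0, y) - vx (0, y) = \<alpha> * (u (0, y) - v (0, y) - 0)"
        using U(4)[rule_format, of y] V(4)[rule_format, of y] by (simp add: right_diff_distrib)
    qed
    show "\<forall>y \<in> {0<..y\<^sub>0}. - (ux (x\<^sub>0, y) - vx (x\<^sub>0, y)) = 0"
      using U(5) V(5) by (fastforce simp: algebra_simps)
    show "\<forall>x \<in> {0..x\<^sub>0}. uy (x, 0) - vy (x, 0) = 0 \<and> - (uy (x, y\<^sub>0) - vy (x, y\<^sub>0)) = 0"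
      using U(6) V(6) by simp
  qed (use U(2) V(2) in \<open>auto intro!: DERIV_diff\<close>)
  from solves_S_homogeneous_zero[OF pos this p] show ?thesis by (simp add: v_def)
qed

(* The discrete solution for h = x0/n is given cell by cell, the i-th cell being
   [(i-1) h, i h], 1 <= i <= n.  Here i is computed from x; at a common end point of two
   cells both formulas agree, see discrete_u_cell. *)
definition cell_index :: "real \<Rightarrow> nat \<Rightarrow> real \<Rightarrow> int" where
  "cell_index x\<^sub>0 n x = min (int n) (\<lfloor>x / (x\<^sub>0 / real n)\<rfloor> + 1)"

definition discrete_u ::
    "real \<Rightarrow> real \<Rightarrow> real \<Rightarrow> real \<Rightarrow> nat \<Rightarrow> real \<Rightarrow> real \<times> real \<Rightarrow> real" where
  "discrete_u x\<^sub>0 g b \<alpha> n q = (\<lambda>(x, y).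
     let h = x\<^sub>0 / real n; i = real_of_int (cell_index x\<^sub>0 n x)
     in (g * x\<^sub>0 - q - h * g * i) * x + b + (g * x\<^sub>0 - q) / \<alpha> - g * h / \<alpha>
        + (i\<^sup>2 - i) / 2 * g * h\<^sup>2)"

lemma discrete_u_cell:
  fixes i n :: nat
  assumes "x\<^sub>0 > 0" "n \<ge> 1" "i \<in> {1..n}"
    and h: "h = x\<^sub>0 / real n" and x: "x \<in> {(real i - 1) * h .. real i * h}"
  shows "discrete_u x\<^sub>0 g b \<alpha> n q (x, y) =
    (g * x\<^sub>0 - q - h * g * real i) * x + b + (g * x\<^sub>0 - q) / \<alpha> - g * h / \<alpha>
      + ((real i)\<^sup>2 - real i) / 2 * g * h\<^sup>2"
proof -
  have hp: "h > 0" using assms by simp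
  show ?thesis
  proof (cases "x = real i * h \<and> i < n")
    case True
    then have "cell_index x\<^sub>0 n x = int i + 1"
      using hp unfolding cell_index_def h[symmetric] by auto
    then show ?thesis using True
      unfolding discrete_u_def Let_def h[symmetric]
      by (simp add: field_simps power2_eq_square)
  next
    case False
    have "cell_index x\<^sub>0 n x = int i"
    proof (cases "x = real i * h")
      case True
      with False assms have "i = n" by auto
      then show ?thesis using True hp unfolding cell_index_def h[symmetric] by auto
    next
      case neq: False
      have "real i - 1 \<le> x / h" "x / h < real i"
        using x neq hp by (auto simp: field_simps)
      then have "\<lfloor>x / h\<rfloor> = int i - 1" by (intro floor_unique) auto
      then show ?thesis using assms unfolding cell_index_def h[symmetric] by auto
    qed
    then show ?thesis unfolding discrete_u_def Let_def h[symmetric] by simp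
  qed
qed

(* The cost functional for a given control-to-state map S: with S the map q |-> u_(alpha q)
   it is J_(2 alpha), with S the map q |-> u^h_(alpha q) it is J^h_(2 alpha).
   In normQ the number q is the constant control. *)
definition cost ::
    "real \<Rightarrow> real \<Rightarrow> real \<Rightarrow> real \<Rightarrow> (real \<Rightarrow> real \<times> real \<Rightarrow> real) \<Rightarrow> real \<Rightarrow> real" where
  "cost x\<^sub>0 y\<^sub>0 M\<^sub>2 z\<^sub>d S q =
     1/2 * (normH x\<^sub>0 y\<^sub>0 (\<lambda>p. S q p - z\<^sub>d))\<^sup>2 + M\<^sub>2 / 2 * (normQ x\<^sub>0 y\<^sub>0 (\<lambda>_. q))\<^sup>2"

lemma normQ_const:
  assumes "y\<^sub>0 > 0"
  shows "(normQ x\<^sub>0 y\<^sub>0 (\<lambda>_. q))\<^sup>2 = y\<^sub>0 * q\<^sup>2"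
  using assms by (simp add: normQ_def set_lebesgue_integral_def)

end

theory Submission
  imports Defs
begin

text \<open>
  Both states are affine in the control with the same slope: on \<open>\<Omega>\<close> they are
  \<open>\<phi> - q * \<psi>\<close> and \<open>\<phi>\<^sub>h - q * \<psi>\<close> with \<open>\<psi> p = fst p + 1 / \<alpha>\<close>, so for a fixed control the
  discretization error \<open>\<phi>\<^sub>h - \<phi>\<close> does not depend on that control. Completing a square
  (\<open>discrete_u_minus_u_sol\<close>) gives, with \<open>s\<close> the distance from \<open>x\<close> to the right end of its cell,
  \<open>\<phi>\<^sub>h - \<phi> = - h * g * (x / 2 + 1 / \<alpha>) + g * s * (s - h) / 2\<close>. As \<open>0 \<le> s \<le> h\<close>, the last term is
  \<open>O(h\<^sup>2)\<close> uniformly, so \<open>(\<phi>\<^sub>h - \<phi>) / h\<close> converges and stays bounded.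

  The costs are therefore quadratic polynomials in \<open>q\<close> with the same leading coefficient, and their
  minimizers are \<open>\<integral>(\<phi> - z\<^sub>d) * \<psi>\<close> and \<open>\<integral>(\<phi>\<^sub>h - z\<^sub>d) * \<psi>\<close> divided by the common number
  \<open>\<integral>\<psi>\<^sup>2 + M\<^sub>2 * y\<^sub>0\<close> (\<open>optimal_control_affine\<close>). By bounded convergence the difference \<open>d\<close> of the two
  optimal controls satisfies \<open>d / h \<longlongrightarrow> c\<close> (\<open>scaled_control_error_tendsto\<close>).

  For (a), the error of the optimal states divided by \<open>h\<close> is \<open>(\<phi>\<^sub>h - \<phi>) / h - (d / h) * \<psi>\<close>; it
  converges pointwise and boundedly, hence in norm. For (b), the derivative of the error is
  \<open>- (g * s + d)\<close> off the grid lines. Divided by \<open>h\<close> it oscillates and has no pointwise limit, but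
  its square can be integrated exactly cell by cell: the squared norm is
  \<open>x\<^sub>0 * y\<^sub>0 * (g\<^sup>2 * h\<^sup>2 / 3 + g * d * h + d\<^sup>2)\<close> (\<open>normH_partial_x_error\<close>), and the limit of its
  quotient by \<open>h\<^sup>2\<close> follows from that of \<open>d / h\<close>.
\<close>

section \<open>Square integrals over the rectangle\<close>

lemma Omega_eq_box: "Omega x\<^sub>0 y\<^sub>0 = box (0, 0) (x\<^sub>0, y\<^sub>0)"
  unfolding Omega_def by (auto simp: mem_box Basis_prod_def)

lemma Omega_sets [measurable]: "Omega x\<^sub>0 y\<^sub>0 \<in> sets borel"
  unfolding Omega_eq_box by simp

lemma emeasure_Omega_finite: "emeasure lebesgue (Omega x\<^sub>0 y\<^sub>0) < \<infinity>"
  unfolding Omega_eq_box using emeasure_lborel_box_finite by simp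

text \<open>
  The class of functions in which all integrands below live: it is closed under the ring operations
  and, as \<open>\<Omega>\<close> has finite measure, consists of functions that are square integrable on \<open>\<Omega>\<close>.
  The bound is asked for on \<open>\<Omega>\<close> only, since the states grow without bound
  outside.
\<close>

definition bounded_measurable :: "real \<Rightarrow> real \<Rightarrow> (real \<times> real \<Rightarrow> real) \<Rightarrow> bool" where
  "bounded_measurable x\<^sub>0 y\<^sub>0 f \<longleftrightarrow>
     f \<in> borel_measurable borel \<and> (\<exists>B. \<forall>p \<in> Omega x\<^sub>0 y\<^sub>0. \<bar>f p\<bar> \<le> B)"

named_theorems bm_intros

lemma bounded_measurable_const [bm_intros]: "bounded_measurable x\<^sub>0 y\<^sub>0 (\<lambda>_. c)"
  unfolding bounded_measurable_def by auto

lemma bounded_measurable_fst [bm_intros]: "bounded_measurable x\<^sub>0 y\<^sub>0 fst"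
  unfolding bounded_measurable_def Omega_def
  by (auto intro!: exI[of _ x\<^sub>0] borel_measurable_continuous_onI continuous_on_fst continuous_on_id)

lemma bounded_measurable_add [bm_intros]:
  assumes "bounded_measurable x\<^sub>0 y\<^sub>0 f" "bounded_measurable x\<^sub>0 y\<^sub>0 g"
  shows "bounded_measurable x\<^sub>0 y\<^sub>0 (\<lambda>p. f p + g p)"
proof -
  obtain A B where "\<forall>p \<in> Omega x\<^sub>0 y\<^sub>0. \<bar>f p\<bar> \<le> A" "\<forall>p \<in> Omega x\<^sub>0 y\<^sub>0. \<bar>g p\<bar> \<le> B"
    using assms unfolding bounded_measurable_def by auto
  then have "\<forall>p \<in> Omega x\<^sub>0 y\<^sub>0. \<bar>f p + g p\<bar> \<le> A + B"
    by (auto intro: order_trans[OF abs_triangle_ineq add_mono])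
  then show ?thesis using assms unfolding bounded_measurable_def by auto
qed

lemma bounded_measurable_mult [bm_intros]:
  assumes "bounded_measurable x\<^sub>0 y\<^sub>0 f" "bounded_measurable x\<^sub>0 y\<^sub>0 g"
  shows "bounded_measurable x\<^sub>0 y\<^sub>0 (\<lambda>p. f p * g p)"
proof -
  obtain A B where "\<forall>p \<in> Omega x\<^sub>0 y\<^sub>0. \<bar>f p\<bar> \<le> A" "\<forall>p \<in> Omega x\<^sub>0 y\<^sub>0. \<bar>g p\<bar> \<le> B"
    using assms unfolding bounded_measurable_def by auto
  then have "\<forall>p \<in> Omega x\<^sub>0 y\<^sub>0. \<bar>f p * g p\<bar> \<le> A * B"
    by (auto simp: abs_mult intro!: mult_mono' elim: order_trans[rotated])
  then show ?thesis using assms unfolding bounded_measurable_def by auto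
qed

lemma bounded_measurable_diff [bm_intros]:
  assumes "bounded_measurable x\<^sub>0 y\<^sub>0 f" "bounded_measurable x\<^sub>0 y\<^sub>0 g"
  shows "bounded_measurable x\<^sub>0 y\<^sub>0 (\<lambda>p. f p - g p)"
  using bounded_measurable_add[OF assms(1)
      bounded_measurable_mult[OF bounded_measurable_const[of _ _ "-1"] assms(2)]] by simp

lemma bounded_measurable_divide_const [bm_intros]:
  "bounded_measurable x\<^sub>0 y\<^sub>0 f \<Longrightarrow> bounded_measurable x\<^sub>0 y\<^sub>0 (\<lambda>p. f p / c)"
  using bounded_measurable_mult[OF bounded_measurable_const[of _ _ "1/c"]] by simp

lemma bounded_measurable_power2 [bm_intros]:
  "bounded_measurable x\<^sub>0 y\<^sub>0 f \<Longrightarrow> bounded_measurable x\<^sub>0 y\<^sub>0 (\<lambda>p. (f p)\<^sup>2)"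
  unfolding power2_eq_square by (intro bm_intros)

lemma bounded_measurable_set_integrable:
  assumes "bounded_measurable x\<^sub>0 y\<^sub>0 f"
  shows "set_integrable lebesgue (Omega x\<^sub>0 y\<^sub>0) f"
proof -
  obtain B where B: "\<forall>p \<in> Omega x\<^sub>0 y\<^sub>0. \<bar>f p\<bar> \<le> B" and f: "f \<in> borel_measurable borel"
    using assms unfolding bounded_measurable_def by auto
  show ?thesis unfolding set_integrable_def
    by (rule integrableI_bounded_set_indicator[where B=B])
      (use B f emeasure_Omega_finite in \<open>auto intro!: measurable_completion\<close>)
qed

text \<open>
  Bounded convergence: a constant is an integrable majorant because \<open>\<Omega>\<close> has finite measure.
\<close>

lemma tendsto_set_integral_Omega:
  assumes f: "\<And>n. bounded_measurable x\<^sub>0 y\<^sub>0 (f n)" "bounded_measurable x\<^sub>0 y\<^sub>0 f'"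
    and B: "\<And>n p. p \<in> Omega x\<^sub>0 y\<^sub>0 \<Longrightarrow> \<bar>f n p\<bar> \<le> B"
    and lim: "\<And>p. p \<in> Omega x\<^sub>0 y\<^sub>0 \<Longrightarrow> (\<lambda>n. f n p) \<longlonglongrightarrow> f' p"
  shows "(\<lambda>n. LINT p : Omega x\<^sub>0 y\<^sub>0 | lebesgue. f n p) \<longlonglongrightarrow> (LINT p : Omega x\<^sub>0 y\<^sub>0 | lebesgue. f' p)"
  unfolding set_lebesgue_integral_def
proof (rule integral_dominated_convergence)
  show "integrable lebesgue (\<lambda>p. indicator (Omega x\<^sub>0 y\<^sub>0) p *\<^sub>R B)"
    using bounded_measurable_set_integrable[OF bounded_measurable_const]
    unfolding set_integrable_def .
  show "AE p in lebesgue. (\<lambda>n. indicator (Omega x\<^sub>0 y\<^sub>0) p *\<^sub>R f n p)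
      \<longlonglongrightarrow> indicator (Omega x\<^sub>0 y\<^sub>0) p *\<^sub>R f' p"
    using lim by (auto simp: indicator_def)
  show "AE p in lebesgue. norm (indicator (Omega x\<^sub>0 y\<^sub>0) p *\<^sub>R f n p)
      \<le> indicator (Omega x\<^sub>0 y\<^sub>0) p *\<^sub>R B" for n
    using B by (auto simp: indicator_def)
qed (use bounded_measurable_set_integrable f in \<open>auto simp: set_integrable_def\<close>)

text \<open>
  Fubini for integrands that depend on \<open>x\<close> only. The one-dimensional integral is taken in the
  Henstock-Kurzweil sense, for which splitting into cells and the fundamental theorem of calculus are
  at hand; nonnegativity makes it a Lebesgue integral.
\<close>

lemma set_integral_Omega_fst:
  assumes f: "bounded_measurable x\<^sub>0 y\<^sub>0 (\<lambda>p. f (fst p))" "f \<in> borel_measurable borel"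
    and "y\<^sub>0 > 0" and I: "(f has_integral I) {0..x\<^sub>0}" and nn: "\<And>x. f x \<ge> 0"
  shows "(LINT p : Omega x\<^sub>0 y\<^sub>0 | lebesgue. f (fst p)) = y\<^sub>0 * I"
proof -
  have J: "(LINT x : {0<..<x\<^sub>0} | lborel. f x) = I"
  proof -
    have "(f has_integral I) {0<..<x\<^sub>0}"
      using I by (simp add: has_integral_open_interval flip: box_real)
    then have "f integrable_on {0<..<x\<^sub>0}" "integral {0<..<x\<^sub>0} f = I" by auto
    moreover have "f absolutely_integrable_on {0<..<x\<^sub>0}"
      using calculation nn by (intro nonnegative_absolutely_integrable_1) auto
    then have "(LINT x : {0<..<x\<^sub>0} | lebesgue. f x) = integral {0<..<x\<^sub>0} f"
      by (rule set_lebesgue_integral_eq_integral)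
    moreover have "(LINT x : {0<..<x\<^sub>0} | lebesgue. f x) = (LINT x : {0<..<x\<^sub>0} | lborel. f x)"
      unfolding set_lebesgue_integral_def using f(2) by (intro integral_completion) auto
    ultimately show ?thesis by simp
  qed
  let ?F = "\<lambda>p. indicator (Omega x\<^sub>0 y\<^sub>0) p *\<^sub>R f (fst p)"
  have meas: "?F \<in> borel_measurable lborel"
    using f(1) unfolding bounded_measurable_def by auto
  have int: "integrable lborel ?F"
    using bounded_measurable_set_integrable[OF f(1)] integrable_completion[OF meas]
    unfolding set_integrable_def by simp
  have "(LINT p : Omega x\<^sub>0 y\<^sub>0 | lebesgue. f (fst p)) = integral\<^sup>L lborel ?F"
    unfolding set_lebesgue_integral_def by (rule integral_completion[OF meas])
  also have "\<dots> = (\<integral>x. (\<integral>y. ?F (x, y) \<partial>lborel) \<partial>lborel)"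
    using lborel_pair.integral_fst'[of ?F] int by (simp add: lborel_prod)
  also have "\<dots> = (\<integral>x. y\<^sub>0 * (indicator {0<..<x\<^sub>0} x *\<^sub>R f x) \<partial>lborel)"
  proof (rule Bochner_Integration.integral_cong[OF refl])
    fix x
    have "(\<lambda>y. ?F (x, y)) = (\<lambda>y. (indicator {0<..<x\<^sub>0} x * f x) * indicator {0<..<y\<^sub>0} y)"
      by (auto simp: Omega_def indicator_def)
    then show "(\<integral>y. ?F (x, y) \<partial>lborel) = y\<^sub>0 * (indicator {0<..<x\<^sub>0} x *\<^sub>R f x)"
      using \<open>y\<^sub>0 > 0\<close> by simp
  qed
  also have "\<dots> = y\<^sub>0 * I"
    using J unfolding set_lebesgue_integral_def by simp
  finally show ?thesis .
qed

lemma normH_square: "(normH x\<^sub>0 y\<^sub>0 f)\<^sup>2 = (LINT p : Omega x\<^sub>0 y\<^sub>0 | lebesgue. (f p)\<^sup>2)"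
  unfolding normH_def set_lebesgue_integral_def
  by (subst real_sqrt_pow2) (auto intro!: integral_nonneg_AE)

lemma normH_cong:
  assumes "\<And>p. p \<in> Omega x\<^sub>0 y\<^sub>0 \<Longrightarrow> f p = g p"
  shows "normH x\<^sub>0 y\<^sub>0 f = normH x\<^sub>0 y\<^sub>0 g"
  unfolding normH_def set_lebesgue_integral_def using assms
  by (auto intro!: arg_cong[where f=sqrt] Bochner_Integration.integral_cong simp: indicator_def)

lemma normH_divide:
  assumes "c \<ge> 0"
  shows "normH x\<^sub>0 y\<^sub>0 (\<lambda>p. f p / c) = normH x\<^sub>0 y\<^sub>0 f / c"
  using assms unfolding normH_def by (simp add: power_divide real_sqrt_divide)

text \<open>
  Meant for derivatives of the discrete solution, whose values on the grid lines are unspecified.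
  Lebesgue measure is complete, so \<open>f\<close> inherits integrability from \<open>g\<close>.
\<close>

lemma normH_spike:
  assumes N: "negligible N" and g: "bounded_measurable x\<^sub>0 y\<^sub>0 g"
    and eq: "\<And>p. p \<in> Omega x\<^sub>0 y\<^sub>0 - N \<Longrightarrow> f p = g p"
  shows "normH x\<^sub>0 y\<^sub>0 f = normH x\<^sub>0 y\<^sub>0 g"
proof -
  have g2: "(\<lambda>p. (g p)\<^sup>2) absolutely_integrable_on Omega x\<^sub>0 y\<^sub>0"
    using g by (intro bounded_measurable_set_integrable bm_intros)
  then have f2: "(\<lambda>p. (f p)\<^sup>2) absolutely_integrable_on Omega x\<^sub>0 y\<^sub>0"
    by (rule absolutely_integrable_spike[OF _ N]) (use eq in auto)
  have "integral (Omega x\<^sub>0 y\<^sub>0) (\<lambda>p. (f p)\<^sup>2) = integral (Omega x\<^sub>0 y\<^sub>0) (\<lambda>p. (g p)\<^sup>2)"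
    by (rule integral_spike[OF N]) (use eq in auto)
  then show ?thesis
    unfolding normH_def using f2 g2 by (simp add: set_lebesgue_integral_eq_integral)
qed

lemma normH_tendsto:
  assumes f: "\<And>n. bounded_measurable x\<^sub>0 y\<^sub>0 (f n)" "bounded_measurable x\<^sub>0 y\<^sub>0 f'"
    and B: "\<And>n p. p \<in> Omega x\<^sub>0 y\<^sub>0 \<Longrightarrow> \<bar>f n p\<bar> \<le> B"
    and lim: "\<And>p. p \<in> Omega x\<^sub>0 y\<^sub>0 \<Longrightarrow> (\<lambda>n. f n p) \<longlonglongrightarrow> f' p"
  shows "(\<lambda>n. normH x\<^sub>0 y\<^sub>0 (f n)) \<longlonglongrightarrow> normH x\<^sub>0 y\<^sub>0 f'"
  unfolding normH_def
proof (intro tendsto_real_sqrt tendsto_set_integral_Omega)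
  show "\<bar>(f n p)\<^sup>2\<bar> \<le> B\<^sup>2" if "p \<in> Omega x\<^sub>0 y\<^sub>0" for n p
    using B[OF that, of n] power_mono[of "\<bar>f n p\<bar>" B 2] by simp
qed (use f lim in \<open>auto intro!: bm_intros tendsto_power\<close>)

section \<open>Minimizers for affine control-to-state maps\<close>

lemma is_arg_min_quadratic:
  fixes K :: real
  assumes "K > 0" and q: "is_arg_min (\<lambda>q. A - B * q + K / 2 * q\<^sup>2) (\<lambda>_. True) q"
  shows "q = B / K"
proof -
  have "A - B * q + K / 2 * q\<^sup>2 \<le> A - B * (B / K) + K / 2 * (B / K)\<^sup>2"
    using q unfolding is_arg_min_def by (meson not_le)
  moreover have "(A - B * q + K / 2 * q\<^sup>2) - (A - B * (B / K) + K / 2 * (B / K)\<^sup>2)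
      = K / 2 * (q - B / K)\<^sup>2"
    using \<open>K > 0\<close> by (simp add: field_simps power2_eq_square)
  ultimately have "K / 2 * (q - B / K)\<^sup>2 \<le> 0" by linarith
  then show ?thesis using \<open>K > 0\<close>
    by (simp add: mult_le_0_iff)
qed

text \<open>
  Expanding the square turns the cost into a quadratic polynomial in the control, whose
  leading coefficient is positive thanks to the penalty term.
\<close>

lemma optimal_control_affine:
  assumes "y\<^sub>0 > 0" "M\<^sub>2 > 0" and bm: "bounded_measurable x\<^sub>0 y\<^sub>0 \<phi>" "bounded_measurable x\<^sub>0 y\<^sub>0 \<psi>"
    and S: "\<And>q p. p \<in> Omega x\<^sub>0 y\<^sub>0 \<Longrightarrow> S q p = \<phi> p - q * \<psi> p"
    and q: "is_arg_min (cost x\<^sub>0 y\<^sub>0 M\<^sub>2 z\<^sub>d S) (\<lambda>_. True) q"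
  shows "q = (LINT p : Omega x\<^sub>0 y\<^sub>0 | lebesgue. (\<phi> p - z\<^sub>d) * \<psi> p)
           / ((LINT p : Omega x\<^sub>0 y\<^sub>0 | lebesgue. (\<psi> p)\<^sup>2) + M\<^sub>2 * y\<^sub>0)"
proof (rule is_arg_min_quadratic)
  let ?I = "\<lambda>f. LINT p : Omega x\<^sub>0 y\<^sub>0 | lebesgue. f p"
  have "?I (\<lambda>p. (\<psi> p)\<^sup>2) \<ge> 0" by (simp flip: normH_square)
  then show "?I (\<lambda>p. (\<psi> p)\<^sup>2) + M\<^sub>2 * y\<^sub>0 > 0" using assms by (simp add: add_nonneg_pos)
  note [simp] = bounded_measurable_set_integrable
  have "cost x\<^sub>0 y\<^sub>0 M\<^sub>2 z\<^sub>d S =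
     (\<lambda>q. 1/2 * ?I (\<lambda>p. (\<phi> p - z\<^sub>d)\<^sup>2) - ?I (\<lambda>p. (\<phi> p - z\<^sub>d) * \<psi> p) * q
          + (?I (\<lambda>p. (\<psi> p)\<^sup>2) + M\<^sub>2 * y\<^sub>0) / 2 * q\<^sup>2)"
  proof
    fix q
    have "(normH x\<^sub>0 y\<^sub>0 (\<lambda>p. S q p - z\<^sub>d))\<^sup>2
        = ?I (\<lambda>p. (\<phi> p - z\<^sub>d)\<^sup>2 - (2 * q) * ((\<phi> p - z\<^sub>d) * \<psi> p) + q\<^sup>2 * (\<psi> p)\<^sup>2)"
      unfolding normH_square set_lebesgue_integral_def
      by (rule Bochner_Integration.integral_cong)
        (auto simp: indicator_def S power2_eq_square algebra_simps)
    also have "\<dots> = ?I (\<lambda>p. (\<phi> p - z\<^sub>d)\<^sup>2) - 2 * q * ?I (\<lambda>p. (\<phi> p - z\<^sub>d) * \<psi> p)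
        + q\<^sup>2 * ?I (\<lambda>p. (\<psi> p)\<^sup>2)"
      by (subst set_integral_add set_integral_diff set_integral_mult_right;
          (intro bounded_measurable_set_integrable bm_intros bm)?)+ simp
    finally show "cost x\<^sub>0 y\<^sub>0 M\<^sub>2 z\<^sub>d S q =
       1/2 * ?I (\<lambda>p. (\<phi> p - z\<^sub>d)\<^sup>2) - ?I (\<lambda>p. (\<phi> p - z\<^sub>d) * \<psi> p) * q
          + (?I (\<lambda>p. (\<psi> p)\<^sup>2) + M\<^sub>2 * y\<^sub>0) / 2 * q\<^sup>2"
      unfolding cost_def normQ_const[OF \<open>y\<^sub>0 > 0\<close>] by (simp add: field_simps)
  qed
  then show "is_arg_min (\<lambda>q. 1/2 * ?I (\<lambda>p. (\<phi> p - z\<^sub>d)\<^sup>2) - ?I (\<lambda>p. (\<phi> p - z\<^sub>d) * \<psi> p) * q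
          + (?I (\<lambda>p. (\<psi> p)\<^sup>2) + M\<^sub>2 * y\<^sub>0) / 2 * q\<^sup>2) (\<lambda>_. True) q" using q by simp
qed

section \<open>The discretization error\<close>

text \<open>
  The distance from \<open>x\<close> to the right end of its cell. It replaces the cell index in the error
  formulas because it is of size \<open>O(h)\<close>, whereas the index grows with \<open>n\<close>.
\<close>

definition node_distance :: "real \<Rightarrow> nat \<Rightarrow> real \<Rightarrow> real" where
  "node_distance x\<^sub>0 n x = real_of_int (cell_index x\<^sub>0 n x) * (x\<^sub>0 / real n) - x"

lemma cell_index_measurable [measurable]:
  "(\<lambda>x. real_of_int (cell_index x\<^sub>0 n x)) \<in> borel_measurable borel"
  unfolding cell_index_def of_int_min by simp

lemma cell_index_bounds:
  assumes "x\<^sub>0 > 0" "x > 0"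
  shows "0 \<le> cell_index x\<^sub>0 n x" "cell_index x\<^sub>0 n x \<le> int n"
proof -
  have "0 \<le> \<lfloor>x / (x\<^sub>0 / real n)\<rfloor>" using assms by simp
  then show "0 \<le> cell_index x\<^sub>0 n x" "cell_index x\<^sub>0 n x \<le> int n"
    unfolding cell_index_def by linarith+
qed

lemma bounded_measurable_cell_index [bm_intros]:
  assumes "x\<^sub>0 > 0"
  shows "bounded_measurable x\<^sub>0 y\<^sub>0 (\<lambda>p. real_of_int (cell_index x\<^sub>0 n (fst p)))"
  unfolding bounded_measurable_def
proof (intro conjI exI ballI)
  show "(\<lambda>p. real_of_int (cell_index x\<^sub>0 n (fst p))) \<in> borel_measurable borel"
    by (rule measurable_compose[OF _ cell_index_measurable])
      (intro borel_measurable_continuous_onI continuous_intros)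
  fix p assume "p \<in> Omega x\<^sub>0 y\<^sub>0"
  then have "0 < fst p" by (auto simp: Omega_def)
  from cell_index_bounds[OF assms this, of n]
  show "\<bar>real_of_int (cell_index x\<^sub>0 n (fst p))\<bar> \<le> real n" by linarith
qed

lemma bounded_measurable_node_distance [bm_intros]:
  "x\<^sub>0 > 0 \<Longrightarrow> bounded_measurable x\<^sub>0 y\<^sub>0 (\<lambda>p. node_distance x\<^sub>0 n (fst p))"
  unfolding node_distance_def by (intro bm_intros)

lemma bounded_measurable_discrete_u [bm_intros]:
  "x\<^sub>0 > 0 \<Longrightarrow> bounded_measurable x\<^sub>0 y\<^sub>0 (discrete_u x\<^sub>0 g b \<alpha> n q)"
  unfolding discrete_u_def Let_def case_prod_beta by (intro bm_intros)

lemma bounded_measurable_u_sol [bm_intros]: "bounded_measurable x\<^sub>0 y\<^sub>0 (u_sol x\<^sub>0 g b \<alpha> q)"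
  unfolding u_sol_def case_prod_beta by (intro bm_intros)

lemma u_sol_affine: "u_sol x\<^sub>0 g b \<alpha> q p = u_sol x\<^sub>0 g b \<alpha> 0 p - q * (fst p + 1 / \<alpha>)"
  by (simp add: u_sol_def case_prod_beta algebra_simps diff_divide_distrib)

lemma discrete_u_affine:
  "discrete_u x\<^sub>0 g b \<alpha> n q p = discrete_u x\<^sub>0 g b \<alpha> n 0 p - q * (fst p + 1 / \<alpha>)"
  by (simp add: discrete_u_def Let_def case_prod_beta algebra_simps diff_divide_distrib)

text \<open>
  On an open cell the index is locally constant, which is what differentiating and integrating
  the discrete solution cell by cell needs.
\<close>

lemma cell_index_interior:
  assumes "x\<^sub>0 > 0" "1 \<le> i" "i \<le> n" and x: "x \<in> {(real i - 1) * (x\<^sub>0 / real n) <..< real i * (x\<^sub>0 / real n)}"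
  shows "cell_index x\<^sub>0 n x = int i"
proof -
  have "x\<^sub>0 / real n > 0" using assms by simp
  then have "real i - 1 \<le> x / (x\<^sub>0 / real n)" "x / (x\<^sub>0 / real n) < real i"
    using x by (auto simp: pos_le_divide_eq pos_divide_less_eq simp del: divide_divide_eq_right)
  then have "\<lfloor>x / (x\<^sub>0 / real n)\<rfloor> = int i - 1" by (intro floor_unique) auto
  then show ?thesis using assms unfolding cell_index_def by auto
qed

lemma node_distance_bounds:
  assumes "x\<^sub>0 > 0" "n \<ge> 1" "x \<in> {0<..<x\<^sub>0}"
  shows "0 \<le> node_distance x\<^sub>0 n x" "node_distance x\<^sub>0 n x \<le> x\<^sub>0 / real n"
proof -
  define h where "h = x\<^sub>0 / real n"
  have hp: "h > 0" and xh: "x < real n * h" using assms by (auto simp: h_def)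
  then have "x / h < real n" by (simp add: pos_divide_less_eq)
  then have "\<lfloor>x / h\<rfloor> < int n" by (simp add: floor_less_iff)
  then have i: "cell_index x\<^sub>0 n x = \<lfloor>x / h\<rfloor> + 1"
    unfolding cell_index_def h_def by simp
  have "real_of_int \<lfloor>x / h\<rfloor> * h \<le> x" "x \<le> (real_of_int \<lfloor>x / h\<rfloor> + 1) * h"
    using hp by (auto simp flip: pos_le_divide_eq pos_divide_le_eq)
  then show "0 \<le> node_distance x\<^sub>0 n x" "node_distance x\<^sub>0 n x \<le> x\<^sub>0 / real n"
    unfolding node_distance_def i h_def[symmetric] by (auto simp: algebra_simps)
qed

text \<open>
  With \<open>s = i * h - x\<close>, all terms apart from \<open>- h * g / \<alpha>\<close> add up to
  \<open>g * (x\<^sup>2 / 2 - i * h * x + (i\<^sup>2 - i) * h\<^sup>2 / 2) = g * (s\<^sup>2 - i * h\<^sup>2) / 2\<close>, and substituting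
  \<open>i * h = x + s\<close> separates the first-order part from the \<open>O(h\<^sup>2)\<close> remainder.
\<close>

lemma discrete_u_minus_u_sol:
  assumes "n \<ge> 1"
  shows "discrete_u x\<^sub>0 g b \<alpha> n q (x, y) - u_sol x\<^sub>0 g b \<alpha> q (x, y) =
      - (x\<^sub>0 / real n) * g * (x / 2 + 1 / \<alpha>)
      + g * (node_distance x\<^sub>0 n x * (node_distance x\<^sub>0 n x - x\<^sub>0 / real n)) / 2"
proof -
  define h where "h = x\<^sub>0 / real n"
  define i where "i = real_of_int (cell_index x\<^sub>0 n x)"
  show ?thesis
    unfolding discrete_u_def u_sol_def node_distance_def Let_def prod.case
      h_def[symmetric] i_def[symmetric]
    by (simp add: field_simps power2_eq_square)
qed

lemma scaled_state_error:
  assumes "x\<^sub>0 > 0" "p \<in> Omega x\<^sub>0 y\<^sub>0" "n \<ge> 1"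
  shows "\<bar>(discrete_u x\<^sub>0 g b \<alpha> n q p - u_sol x\<^sub>0 g b \<alpha> q p) / (x\<^sub>0 / real n)
           - (- g * (fst p / 2 + 1 / \<alpha>))\<bar> \<le> \<bar>g\<bar> * (x\<^sub>0 / real n)"
proof -
  define h where "h = x\<^sub>0 / real n"
  obtain x y where p: "p = (x, y)" "x \<in> {0<..<x\<^sub>0}" using assms(2) by (auto simp: Omega_def)
  define s where "s = node_distance x\<^sub>0 n x"
  have hp: "h > 0" using assms by (simp add: h_def)
  have s: "0 \<le> s" "s \<le> h"
    using node_distance_bounds[OF assms(1,3) p(2)] by (auto simp: s_def h_def)
  have "(discrete_u x\<^sub>0 g b \<alpha> n q p - u_sol x\<^sub>0 g b \<alpha> q p) / h
           - (- g * (fst p / 2 + 1 / \<alpha>)) = g * (s * (s - h) / h) / 2"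
    unfolding p(1) discrete_u_minus_u_sol[OF assms(3)] h_def[symmetric] s_def[symmetric] fst_conv
    using hp by (simp add: field_simps)
  moreover have half: "\<bar>a / 2\<bar> \<le> c" if "\<bar>a\<bar> \<le> c" for a c :: real
    using that by linarith
  moreover have "\<bar>s * (s - h) / h\<bar> \<le> h"
  proof -
    have "\<bar>s * (s - h)\<bar> \<le> h * h" unfolding abs_mult using s by (intro mult_mono) auto
    then show ?thesis using hp by (simp add: pos_divide_le_eq)
  qed
  then have "\<bar>g * (s * (s - h) / h)\<bar> \<le> \<bar>g\<bar> * h"
    unfolding abs_mult[of g] by (intro mult_left_mono) auto
  then have "\<bar>g * (s * (s - h) / h) / 2\<bar> \<le> \<bar>g\<bar> * h"
    by (rule half)
  ultimately show ?thesis by (simp add: h_def)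
qed

lemma scaled_state_error_tendsto:
  assumes "x\<^sub>0 > 0" "p \<in> Omega x\<^sub>0 y\<^sub>0"
  shows "(\<lambda>n. (discrete_u x\<^sub>0 g b \<alpha> n q p - u_sol x\<^sub>0 g b \<alpha> q p) / (x\<^sub>0 / real n))
           \<longlonglongrightarrow> - g * (fst p / 2 + 1 / \<alpha>)"
proof (rule LIM_zero_cancel, rule Lim_null_comparison)
  show "\<forall>\<^sub>F n in sequentially.
      norm ((discrete_u x\<^sub>0 g b \<alpha> n q p - u_sol x\<^sub>0 g b \<alpha> q p) / (x\<^sub>0 / real n)
           - (- g * (fst p / 2 + 1 / \<alpha>))) \<le> \<bar>g\<bar> * (x\<^sub>0 / real n)"
    using scaled_state_error[OF assms] by (auto simp: eventually_sequentially intro!: exI[of _ 1])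
  show "(\<lambda>n. \<bar>g\<bar> * (x\<^sub>0 / real n)) \<longlonglongrightarrow> 0"
    by (intro tendsto_mult_right_zero lim_const_over_n)
qed

text \<open>
  For \<open>n = 0\<close> the quotient is \<open>0\<close>, because \<open>x\<^sub>0 / 0 = 0\<close> and division by \<open>0\<close> yields \<open>0\<close>. The bound
  thus holds for all \<open>n\<close>, as bounded convergence along the whole sequence asks for.
\<close>

lemma scaled_state_error_bound:
  assumes "x\<^sub>0 > 0" "\<alpha> > 0" "p \<in> Omega x\<^sub>0 y\<^sub>0"
  shows "\<bar>(discrete_u x\<^sub>0 g b \<alpha> n q p - u_sol x\<^sub>0 g b \<alpha> q p) / (x\<^sub>0 / real n)\<bar>
           \<le> \<bar>g\<bar> * (2 * x\<^sub>0 + 1 / \<alpha>)"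
proof (cases "n = 0")
  case True
  then show ?thesis using assms by simp
next
  case False
  have "\<bar>- g * (fst p / 2 + 1 / \<alpha>)\<bar> \<le> \<bar>g\<bar> * (x\<^sub>0 + 1 / \<alpha>)"
    unfolding abs_mult using assms by (intro mult_mono) (auto simp: Omega_def)
  moreover have "\<bar>g\<bar> * (x\<^sub>0 / real n) \<le> \<bar>g\<bar> * x\<^sub>0"
    using assms False by (intro mult_left_mono) (auto simp: divide_le_eq)
  moreover have "\<bar>g\<bar> * (2 * x\<^sub>0 + 1 / \<alpha>) = \<bar>g\<bar> * (x\<^sub>0 + 1 / \<alpha>) + \<bar>g\<bar> * x\<^sub>0"
    by (simp add: algebra_simps)
  ultimately show ?thesis
    using scaled_state_error[OF assms(1,3), of n g b \<alpha> q] False by linarith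
qed

text \<open>
  The two minimizers share the denominator \<open>\<integral>\<psi>\<^sup>2 + M\<^sub>2 * y\<^sub>0\<close>, so their difference is linear in the
  discretization error of the states, and the limit can be taken under the integral.
\<close>

lemma scaled_control_error_tendsto:
  assumes pos: "x\<^sub>0 > 0" "y\<^sub>0 > 0" "M\<^sub>2 > 0" "\<alpha> > 0"
    and q: "is_arg_min (cost x\<^sub>0 y\<^sub>0 M\<^sub>2 z\<^sub>d u) (\<lambda>_. True) q"
    and u: "\<And>q p. p \<in> Omega x\<^sub>0 y\<^sub>0 \<Longrightarrow> u q p = u_sol x\<^sub>0 g b \<alpha> q p"
    and qh: "\<And>n. n \<ge> 1 \<Longrightarrow>
      is_arg_min (cost x\<^sub>0 y\<^sub>0 M\<^sub>2 z\<^sub>d (discrete_u x\<^sub>0 g b \<alpha> n)) (\<lambda>_. True) (qh n)"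
  shows "\<exists>c. (\<lambda>n. (qh n - q) / (x\<^sub>0 / real n)) \<longlonglongrightarrow> c"
proof
  let ?I = "\<lambda>f. LINT p : Omega x\<^sub>0 y\<^sub>0 | lebesgue. f p"
  let ?\<psi> = "\<lambda>p. fst p + 1 / \<alpha>"
  let ?K = "?I (\<lambda>p. (?\<psi> p)\<^sup>2) + M\<^sub>2 * y\<^sub>0"
  let ?e = "\<lambda>n p. (discrete_u x\<^sub>0 g b \<alpha> n 0 p - u_sol x\<^sub>0 g b \<alpha> 0 p) / (x\<^sub>0 / real n)"
  have bm: "bounded_measurable x\<^sub>0 y\<^sub>0 (\<lambda>p. (discrete_u x\<^sub>0 g b \<alpha> n 0 p - z\<^sub>d) * ?\<psi> p)"
    "bounded_measurable x\<^sub>0 y\<^sub>0 (\<lambda>p. (u_sol x\<^sub>0 g b \<alpha> 0 p - z\<^sub>d) * ?\<psi> p)" for n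
    using pos by (intro bm_intros; simp)+
  have q_eq: "q = ?I (\<lambda>p. (u_sol x\<^sub>0 g b \<alpha> 0 p - z\<^sub>d) * ?\<psi> p) / ?K"
  proof (rule optimal_control_affine[OF pos(2,3) _ _ _ q])
    show "u q' p = u_sol x\<^sub>0 g b \<alpha> 0 p - q' * ?\<psi> p" if "p \<in> Omega x\<^sub>0 y\<^sub>0" for q' p
      by (rule trans[OF u[OF that] u_sol_affine])
  qed (intro bm_intros)+
  have qh_eq: "qh n = ?I (\<lambda>p. (discrete_u x\<^sub>0 g b \<alpha> n 0 p - z\<^sub>d) * ?\<psi> p) / ?K" if "n \<ge> 1" for n
  proof (rule optimal_control_affine[OF pos(2,3) _ _ _ qh[OF that]])
    show "discrete_u x\<^sub>0 g b \<alpha> n q' p = discrete_u x\<^sub>0 g b \<alpha> n 0 p - q' * ?\<psi> p" for q' p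
      by (rule discrete_u_affine)
  qed (intro bm_intros pos)+
  have diff: "(qh n - q) / (x\<^sub>0 / real n) = ?I (\<lambda>p. ?e n p * ?\<psi> p) / ?K" if "n \<ge> 1" for n
  proof -
    have pt: "((r - t) * c - (s - t) * c) / k = (r - s) / k * c" for r s t c k :: real
    proof -
      have "(r - t) * c - (s - t) * c = (r - s) * c" by (simp add: algebra_simps)
      then show ?thesis by (simp only: times_divide_eq_left)
    qed
    have "qh n - q = ?I (\<lambda>p. (discrete_u x\<^sub>0 g b \<alpha> n 0 p - z\<^sub>d) * ?\<psi> p
        - (u_sol x\<^sub>0 g b \<alpha> 0 p - z\<^sub>d) * ?\<psi> p) / ?K"
      unfolding q_eq qh_eq[OF that]
      using set_integral_diff(2)[OF bm[THEN bounded_measurable_set_integrable]]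
      by (simp add: diff_divide_distrib)
    then have "(qh n - q) / (x\<^sub>0 / real n) = ?I (\<lambda>p. (discrete_u x\<^sub>0 g b \<alpha> n 0 p - z\<^sub>d) * ?\<psi> p
        - (u_sol x\<^sub>0 g b \<alpha> 0 p - z\<^sub>d) * ?\<psi> p) / (x\<^sub>0 / real n) / ?K"
      by (simp only: divide_divide_eq_left mult.commute[of ?K])
    also have "\<dots> = ?I (\<lambda>p. ?e n p * ?\<psi> p) / ?K"
      by (simp only: pt set_integral_divide_zero[symmetric])
    finally show ?thesis .
  qed
  have "(\<lambda>n. ?I (\<lambda>p. ?e n p * ?\<psi> p)) \<longlonglongrightarrow> ?I (\<lambda>p. (- g * (fst p / 2 + 1 / \<alpha>)) * ?\<psi> p)"
  proof (rule tendsto_set_integral_Omega)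
    show "\<bar>?e n p * ?\<psi> p\<bar> \<le> (\<bar>g\<bar> * (2 * x\<^sub>0 + 1 / \<alpha>)) * (x\<^sub>0 + 1 / \<alpha>)"
      if "p \<in> Omega x\<^sub>0 y\<^sub>0" for n p
      unfolding abs_mult[of "?e n p"]
      using that pos by (intro mult_mono scaled_state_error_bound) (auto simp: Omega_def)
    show "(\<lambda>n. ?e n p * ?\<psi> p) \<longlonglongrightarrow> (- g * (fst p / 2 + 1 / \<alpha>)) * ?\<psi> p"
      if "p \<in> Omega x\<^sub>0 y\<^sub>0" for p
      using that pos by (intro tendsto_mult_right scaled_state_error_tendsto)
  qed (use pos in \<open>(intro bm_intros; simp)+\<close>)
  moreover have "?K \<noteq> 0"
  proof -
    have "?I (\<lambda>p. (?\<psi> p)\<^sup>2) \<ge> 0" by (simp flip: normH_square)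
    then show ?thesis using pos by (smt (verit) mult_pos_pos)
  qed
  ultimately have "(\<lambda>n. ?I (\<lambda>p. ?e n p * ?\<psi> p) / ?K)
      \<longlonglongrightarrow> ?I (\<lambda>p. (- g * (fst p / 2 + 1 / \<alpha>)) * ?\<psi> p) / ?K"
    by (intro tendsto_divide tendsto_const)
  then show "(\<lambda>n. (qh n - q) / (x\<^sub>0 / real n))
      \<longlonglongrightarrow> ?I (\<lambda>p. (- g * (fst p / 2 + 1 / \<alpha>)) * ?\<psi> p) / ?K"
    by (rule Lim_transform_eventually)
      (use diff in \<open>auto simp: eventually_sequentially intro!: exI[of _ 1]\<close>)
qed

section \<open>The derivative of the discretization error\<close>

lemma has_integral_affine_square:
  fixes g d e :: real
  assumes "h \<ge> 0"
  shows "((\<lambda>x. (g * (e - x) + d)\<^sup>2) has_integral g\<^sup>2 * h^3 / 3 + g * d * h\<^sup>2 + d\<^sup>2 * h) {e - h..e}"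
proof -
  let ?F = "\<lambda>x. - (g\<^sup>2 * (e - x)^3 / 3 + g * d * (e - x)\<^sup>2 + d\<^sup>2 * (e - x))"
  have "((\<lambda>x. (g * (e - x) + d)\<^sup>2) has_integral ?F e - ?F (e - h)) {e - h..e}"
  proof (rule fundamental_theorem_of_calculus)
    show "(?F has_vector_derivative (g * (e - x) + d)\<^sup>2) (at x within {e - h..e})" for x
      unfolding has_real_derivative_iff_has_vector_derivative[symmetric]
      by (auto intro!: derivative_eq_intros simp: field_simps power2_eq_square)
  qed (use assms in simp)
  also have "?F e - ?F (e - h) = g\<^sup>2 * h^3 / 3 + g * d * h\<^sup>2 + d\<^sup>2 * h" by simp
  finally show ?thesis .
qed

text \<open>
  The node distance runs through \<open>{0..h}\<close> in the same way on every cell, so each cell contributes the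
  same amount.
\<close>

lemma has_integral_node_distance_square:
  assumes "x\<^sub>0 > 0" "k \<le> n" "n \<ge> 1" and h: "h = x\<^sub>0 / real n"
  shows "((\<lambda>x. (g * node_distance x\<^sub>0 n x + d)\<^sup>2) has_integral
      real k * (g\<^sup>2 * h^3 / 3 + g * d * h\<^sup>2 + d\<^sup>2 * h)) {0..real k * h}"
  using assms(2)
proof (induction k)
  case 0
  then show ?case by (auto intro: has_integral_null_real)
next
  case (Suc k)
  have hp: "h > 0" using assms by simp
  let ?f = "\<lambda>x. (g * node_distance x\<^sub>0 n x + d)\<^sup>2"
  have "((\<lambda>x. (g * (real (Suc k) * h - x) + d)\<^sup>2) has_integral
      g\<^sup>2 * h^3 / 3 + g * d * h\<^sup>2 + d\<^sup>2 * h) {real (Suc k) * h - h..real (Suc k) * h}"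
    using hp by (intro has_integral_affine_square) simp
  then have "(?f has_integral g\<^sup>2 * h^3 / 3 + g * d * h\<^sup>2 + d\<^sup>2 * h)
      {real (Suc k) * h - h..real (Suc k) * h}"
  proof (rule has_integral_spike_finite[rotated 2])
    show "finite {real (Suc k) * h - h, real (Suc k) * h}" by simp
    fix x assume "x \<in> {real (Suc k) * h - h..real (Suc k) * h} - {real (Suc k) * h - h, real (Suc k) * h}"
    then have "x \<in> {(real (Suc k) - 1) * h<..<real (Suc k) * h}" by (auto simp: algebra_simps)
    then have "cell_index x\<^sub>0 n x = int (Suc k)"
      using Suc.prems assms(1) unfolding h by (intro cell_index_interior) auto
    then show "?f x = (g * (real (Suc k) * h - x) + d)\<^sup>2"
      unfolding node_distance_def h[symmetric] by simp
  qed
  moreover have "real (Suc k) * h - h = real k * h" by (simp add: algebra_simps)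
  ultimately have "(?f has_integral g\<^sup>2 * h^3 / 3 + g * d * h\<^sup>2 + d\<^sup>2 * h)
      {real k * h..real (Suc k) * h}" by simp
  then have "(?f has_integral real k * (g\<^sup>2 * h^3 / 3 + g * d * h\<^sup>2 + d\<^sup>2 * h)
      + (g\<^sup>2 * h^3 / 3 + g * d * h\<^sup>2 + d\<^sup>2 * h)) {0..real (Suc k) * h}"
    using Suc hp by (intro has_integral_combine[of 0 "real k * h"]) auto
  also have "real k * (g\<^sup>2 * h^3 / 3 + g * d * h\<^sup>2 + d\<^sup>2 * h)
      + (g\<^sup>2 * h^3 / 3 + g * d * h\<^sup>2 + d\<^sup>2 * h)
      = real (Suc k) * (g\<^sup>2 * h^3 / 3 + g * d * h\<^sup>2 + d\<^sup>2 * h)"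
    by (simp only: of_nat_Suc distrib_right mult_1 add_ac)
  finally show ?case .
qed

lemma normH_affine_node_distance:
  assumes "x\<^sub>0 > 0" "y\<^sub>0 > 0" "n \<ge> 1" and h: "h = x\<^sub>0 / real n"
  shows "normH x\<^sub>0 y\<^sub>0 (\<lambda>p. g * node_distance x\<^sub>0 n (fst p) + d)
       = sqrt (x\<^sub>0 * y\<^sub>0 * (g\<^sup>2 * h\<^sup>2 / 3 + g * d * h + d\<^sup>2))"
proof -
  have nh: "real n * h = x\<^sub>0" using assms by simp
  have "((\<lambda>x. (g * node_distance x\<^sub>0 n x + d)\<^sup>2) has_integral
      real n * (g\<^sup>2 * h^3 / 3 + g * d * h\<^sup>2 + d\<^sup>2 * h)) {0..x\<^sub>0}"
    using has_integral_node_distance_square[OF assms(1) order_refl assms(3) h] unfolding nh .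
  also have "real n * (g\<^sup>2 * h^3 / 3 + g * d * h\<^sup>2 + d\<^sup>2 * h)
      = x\<^sub>0 * (g\<^sup>2 * h\<^sup>2 / 3 + g * d * h + d\<^sup>2)"
    unfolding nh[symmetric] by (simp add: algebra_simps power2_eq_square power3_eq_cube)
  finally have "(LINT p : Omega x\<^sub>0 y\<^sub>0 | lebesgue. (g * node_distance x\<^sub>0 n (fst p) + d)\<^sup>2)
      = y\<^sub>0 * (x\<^sub>0 * (g\<^sup>2 * h\<^sup>2 / 3 + g * d * h + d\<^sup>2))"
  proof (intro set_integral_Omega_fst)
    show "(\<lambda>x. (g * node_distance x\<^sub>0 n x + d)\<^sup>2) \<in> borel_measurable borel"
      unfolding node_distance_def by measurable
  qed (use assms in \<open>auto intro!: bm_intros\<close>)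
  then show ?thesis unfolding normH_def by (simp add: mult_ac)
qed

lemma partial_x_u_sol:
  assumes "p \<in> Omega x\<^sub>0 y\<^sub>0" and u: "\<And>p. p \<in> Omega x\<^sub>0 y\<^sub>0 \<Longrightarrow> u p = u_sol x\<^sub>0 g b \<alpha> q p"
  shows "partial_x u p = g * x\<^sub>0 - q - g * fst p"
proof -
  obtain x y where p: "p = (x, y)" "x \<in> {0<..<x\<^sub>0}" "y \<in> {0<..<y\<^sub>0}"
    using assms by (auto simp: Omega_def)
  have "((\<lambda>s. u_sol x\<^sub>0 g b \<alpha> q (s, y)) has_real_derivative g * x\<^sub>0 - q - g * x) (at x)"
    unfolding u_sol_def prod.case by (auto intro!: derivative_eq_intros)
  then have "((\<lambda>s. u (s, y)) has_real_derivative g * x\<^sub>0 - q - g * x) (at x)"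
    by (rule has_field_derivative_transform_within_open[OF _ open_greaterThanLessThan p(2)])
      (use u p(3) in \<open>auto simp: Omega_def\<close>)
  then show ?thesis unfolding partial_x_def p by (simp add: DERIV_imp_deriv)
qed

text \<open>
  Grid points have to be excluded: there the discrete solution has a kink (unless \<open>g = 0\<close>), so that
  \<open>deriv\<close> returns an arbitrary value.
\<close>

lemma partial_x_discrete_u:
  assumes "x\<^sub>0 > 0" "n \<ge> 1" "p \<in> Omega x\<^sub>0 y\<^sub>0" and h: "h = x\<^sub>0 / real n"
    and N: "\<And>k::nat. k \<le> n \<Longrightarrow> fst p \<noteq> real k * h"
  shows "partial_x (discrete_u x\<^sub>0 g b \<alpha> n q) p
       = g * x\<^sub>0 - q - g * (fst p + node_distance x\<^sub>0 n (fst p))"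
proof -
  obtain x y where p: "p = (x, y)" "0 < x" "x < x\<^sub>0" using assms by (auto simp: Omega_def)
  have hp: "h > 0" using assms by simp
  \<comment> \<open>The number of the cell of \<open>x\<close>, where the floor counts the cells to its left.\<close>
  define i where "i = nat \<lfloor>x / h\<rfloor> + 1"
  have "x < real n * h" using p assms by simp
  then have "x / h < real n" using hp by (simp add: pos_divide_less_eq)
  then have i1: "i \<le> n" unfolding i_def using p hp by (simp add: nat_less_iff floor_less_iff Suc_le_eq)
  have ri: "real i = real_of_int \<lfloor>x / h\<rfloor> + 1" using p hp by (simp add: i_def)
  have le: "(real i - 1) * h \<le> x" "x \<le> real i * h"
    unfolding ri using hp by (auto simp flip: pos_le_divide_eq pos_divide_le_eq)
  have "x \<noteq> real i * h" "x \<noteq> (real i - 1) * h"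
    using N[of i] N[of "i - 1"] i1 p by (auto simp: i_def)
  with le have x: "x \<in> {(real i - 1) * h <..< real i * h}" by auto
  have cell: "cell_index x\<^sub>0 n s = int i" if "s \<in> {(real i - 1) * h <..< real i * h}" for s
    using that i1 assms(1) unfolding h by (intro cell_index_interior) (auto simp: i_def)
  let ?L = "\<lambda>s. (g * x\<^sub>0 - q - h * g * real i) * s + b + (g * x\<^sub>0 - q) / \<alpha> - g * h / \<alpha>
        + ((real i)\<^sup>2 - real i) / 2 * g * h\<^sup>2"
  have "(?L has_real_derivative g * x\<^sub>0 - q - h * g * real i) (at x)"
    by (auto intro!: derivative_eq_intros)
  then have "((\<lambda>s. discrete_u x\<^sub>0 g b \<alpha> n q (s, y)) has_real_derivative
      g * x\<^sub>0 - q - h * g * real i) (at x)"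
    by (rule has_field_derivative_transform_within_open[OF _ open_greaterThanLessThan x])
      (simp add: discrete_u_def cell Let_def flip: h)
  then show ?thesis
    unfolding partial_x_def p(1) node_distance_def by (simp add: DERIV_imp_deriv cell[OF x] flip: h)
qed

lemma negligible_grid_lines:
  "negligible {p :: real \<times> real. \<exists>k::nat. k \<le> n \<and> fst p = real k * h}"
proof -
  have "negligible (\<Union>k\<in>{..n}. {p :: real \<times> real. p \<bullet> (1, 0) = real k * h})"
    by (intro negligible_Union) (auto intro!: negligible_standard_hyperplane simp: Basis_prod_def)
  also have "(\<Union>k\<in>{..n}. {p :: real \<times> real. p \<bullet> (1, 0) = real k * h})
      = {p. \<exists>k::nat. k \<le> n \<and> fst p = real k * h}"
    by auto
  finally show ?thesis .
qed

lemma normH_partial_x_error: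
  assumes "x\<^sub>0 > 0" "y\<^sub>0 > 0" "n \<ge> 1" and h: "h = x\<^sub>0 / real n"
    and u: "\<And>p. p \<in> Omega x\<^sub>0 y\<^sub>0 \<Longrightarrow> u p = u_sol x\<^sub>0 g b \<alpha> q p"
  shows "normH x\<^sub>0 y\<^sub>0 (\<lambda>p. partial_x (discrete_u x\<^sub>0 g b \<alpha> n q') p - partial_x u p)
       = sqrt (x\<^sub>0 * y\<^sub>0 * (g\<^sup>2 * h\<^sup>2 / 3 + g * (q' - q) * h + (q' - q)\<^sup>2))"
proof -
  have "normH x\<^sub>0 y\<^sub>0 (\<lambda>p. partial_x (discrete_u x\<^sub>0 g b \<alpha> n q') p - partial_x u p)
      = normH x\<^sub>0 y\<^sub>0 (\<lambda>p. (- g) * node_distance x\<^sub>0 n (fst p) + (q - q'))"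
  \<comment> \<open>The sign is absorbed into the parameters, since the norm is that of \<open>- (g * s + (q' - q))\<close>.\<close>
  proof (rule normH_spike[OF negligible_grid_lines[of n h]])
    fix p assume p: "p \<in> Omega x\<^sub>0 y\<^sub>0 - {p. \<exists>k::nat. k \<le> n \<and> fst p = real k * h}"
    then show "partial_x (discrete_u x\<^sub>0 g b \<alpha> n q') p - partial_x u p
        = (- g) * node_distance x\<^sub>0 n (fst p) + (q - q')"
      using partial_x_discrete_u[OF assms(1,3) _ h, of p y\<^sub>0 g b \<alpha> q'] partial_x_u_sol[of p x\<^sub>0 y\<^sub>0 u g b \<alpha> q, OF _ u]
      by (auto simp: algebra_simps)
  qed (use assms in \<open>auto intro!: bm_intros\<close>)
  also have "\<dots> = sqrt (x\<^sub>0 * y\<^sub>0 * (g\<^sup>2 * h\<^sup>2 / 3 + g * (q' - q) * h + (q' - q)\<^sup>2))"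
    unfolding normH_affine_node_distance[OF assms(1-3) h]
    by (simp add: algebra_simps power2_eq_square)
  finally show ?thesis .
qed

section \<open>First-order expansions\<close>

lemma linear_expansion_smallo:
  fixes f :: "nat \<Rightarrow> real"
  assumes "x\<^sub>0 > 0" and lim: "(\<lambda>n. f n / (x\<^sub>0 / real n)) \<longlonglongrightarrow> C"
  shows "(\<lambda>n. f n - C * (x\<^sub>0 / real n)) \<in> o[sequentially](\<lambda>n. x\<^sub>0 / real n)"
proof (rule smalloI_tendsto)
  show nz: "\<forall>\<^sub>F n in sequentially. x\<^sub>0 / real n \<noteq> 0"
    using assms by (auto simp: eventually_sequentially intro!: exI[of _ 1])
  have "(\<lambda>n. f n / (x\<^sub>0 / real n) - C) \<longlonglongrightarrow> 0" using lim by (rule LIM_zero)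
  moreover have "\<forall>\<^sub>F n in sequentially.
      f n / (x\<^sub>0 / real n) - C = (f n - C * (x\<^sub>0 / real n)) / (x\<^sub>0 / real n)"
    using nz by eventually_elim (simp only: diff_divide_distrib[of "f _"] nonzero_mult_div_cancel_right not_False_eq_True)
  ultimately show "(\<lambda>n. (f n - C * (x\<^sub>0 / real n)) / (x\<^sub>0 / real n)) \<longlonglongrightarrow> 0"
    by (rule Lim_transform_eventually)
qed

theorem lemma14:
  fixes x\<^sub>0 y\<^sub>0 g b z\<^sub>d M\<^sub>2 \<alpha> :: real
    and u :: "real \<Rightarrow> real \<times> real \<Rightarrow> real"
    and q_op :: real and qh_op :: "nat \<Rightarrow> real"
  assumes "x\<^sub>0 > 0" and "y\<^sub>0 > 0" and "M\<^sub>2 > 0" and "\<alpha> > 0"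
    and "\<And>q. solves_S x\<^sub>0 y\<^sub>0 g b \<alpha> q (u q)"
    and "is_arg_min (cost x\<^sub>0 y\<^sub>0 M\<^sub>2 z\<^sub>d u) (\<lambda>_. True) q_op"
    and "\<And>n. n \<ge> 1 \<Longrightarrow>
           is_arg_min (cost x\<^sub>0 y\<^sub>0 M\<^sub>2 z\<^sub>d (discrete_u x\<^sub>0 g b \<alpha> n)) (\<lambda>_. True) (qh_op n)"
  shows "\<exists>C10 C11 :: real.
      (\<lambda>n. normH x\<^sub>0 y\<^sub>0 (\<lambda>p. discrete_u x\<^sub>0 g b \<alpha> n (qh_op n) p - u q_op p)
             - C10 * (x\<^sub>0 / real n)) \<in> o[sequentially](\<lambda>n. x\<^sub>0 / real n) \<and>
      (\<lambda>n. normH x\<^sub>0 y\<^sub>0 (\<lambda>p. partial_x (discrete_u x\<^sub>0 g b \<alpha> n (qh_op n)) p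
                                 - partial_x (u q_op) p)
             - C11 * (x\<^sub>0 / real n)) \<in> o[sequentially](\<lambda>n. x\<^sub>0 / real n)"
proof -
  have u: "u q p = u_sol x\<^sub>0 g b \<alpha> q p" if "p \<in> Omega x\<^sub>0 y\<^sub>0" for q p
    using that by (intro solves_S_unique[OF assms(1,2,4,5)]) (auto simp: Omega_def)
  let ?d = "\<lambda>n. (qh_op n - q_op) / (x\<^sub>0 / real n)"
  obtain c where c: "?d \<longlonglongrightarrow> c"
    using scaled_control_error_tendsto[OF assms(1-4,6) u assms(7)] by blast
  then obtain D where D: "\<And>n. \<bar>?d n\<bar> \<le> D"
    using convergent_imp_Bseq[OF convergentI[OF c]] unfolding Bseq_def real_norm_def by blast

  let ?e = "\<lambda>n p. (discrete_u x\<^sub>0 g b \<alpha> n q_op p - u_sol x\<^sub>0 g b \<alpha> q_op p) / (x\<^sub>0 / real n)"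
  let ?k = "\<lambda>p. - g * (fst p / 2 + 1 / \<alpha>) - c * (fst p + 1 / \<alpha>)"
  have split: "(discrete_u x\<^sub>0 g b \<alpha> n (qh_op n) p - u q_op p) / (x\<^sub>0 / real n)
      = ?e n p - ?d n * (fst p + 1 / \<alpha>)" if "p \<in> Omega x\<^sub>0 y\<^sub>0" for n p
    \<comment> \<open>Passing through the control \<open>0\<close> compares both states at the same control \<open>q_op\<close>.\<close>
    unfolding u[OF that] discrete_u_affine[of _ _ _ _ _ "qh_op n"]
      discrete_u_affine[of _ _ _ _ _ q_op]
    by (simp add: algebra_simps diff_divide_distrib add_divide_distrib)
  have "(\<lambda>n. normH x\<^sub>0 y\<^sub>0 (\<lambda>p. ?e n p - ?d n * (fst p + 1 / \<alpha>))) \<longlonglongrightarrow> normH x\<^sub>0 y\<^sub>0 ?k"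
  proof (rule normH_tendsto)
    show "\<bar>?e n p - ?d n * (fst p + 1 / \<alpha>)\<bar>
        \<le> \<bar>g\<bar> * (2 * x\<^sub>0 + 1 / \<alpha>) + D * (x\<^sub>0 + 1 / \<alpha>)" if "p \<in> Omega x\<^sub>0 y\<^sub>0" for n p
    proof -
      have "\<bar>?d n * (fst p + 1 / \<alpha>)\<bar> \<le> D * (x\<^sub>0 + 1 / \<alpha>)"
        unfolding abs_mult using that assms(4) D[of n] D[of 0]
        by (intro mult_mono) (auto simp: Omega_def)
      then show ?thesis
        using scaled_state_error_bound[OF assms(1,4) that, of g b n q_op] by linarith
    qed
    show "(\<lambda>n. ?e n p - ?d n * (fst p + 1 / \<alpha>)) \<longlonglongrightarrow> ?k p" if "p \<in> Omega x\<^sub>0 y\<^sub>0" for p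
      using that assms(1) c by (intro tendsto_diff tendsto_mult_right scaled_state_error_tendsto)
  qed (use assms(1) in \<open>(intro bm_intros; simp)+\<close>)
  moreover have "normH x\<^sub>0 y\<^sub>0 (\<lambda>p. ?e n p - ?d n * (fst p + 1 / \<alpha>))
      = normH x\<^sub>0 y\<^sub>0 (\<lambda>p. discrete_u x\<^sub>0 g b \<alpha> n (qh_op n) p - u q_op p) / (x\<^sub>0 / real n)" for n
    using split assms(1) by (subst normH_divide[symmetric]) (auto intro!: normH_cong)
  ultimately have a: "(\<lambda>n. normH x\<^sub>0 y\<^sub>0 (\<lambda>p. discrete_u x\<^sub>0 g b \<alpha> n (qh_op n) p - u q_op p)
      / (x\<^sub>0 / real n)) \<longlonglongrightarrow> normH x\<^sub>0 y\<^sub>0 ?k"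
    by simp

  let ?C = "sqrt (x\<^sub>0 * y\<^sub>0 * (g\<^sup>2 / 3 + g * c + c\<^sup>2))"
  have "(\<lambda>n. sqrt (x\<^sub>0 * y\<^sub>0 * (g\<^sup>2 / 3 + g * ?d n + (?d n)\<^sup>2))) \<longlonglongrightarrow> ?C"
    by (intro tendsto_intros c)
  moreover have "\<forall>\<^sub>F n in sequentially. sqrt (x\<^sub>0 * y\<^sub>0 * (g\<^sup>2 / 3 + g * ?d n + (?d n)\<^sup>2))
      = normH x\<^sub>0 y\<^sub>0 (\<lambda>p. partial_x (discrete_u x\<^sub>0 g b \<alpha> n (qh_op n)) p - partial_x (u q_op) p)
        / (x\<^sub>0 / real n)"
  proof (rule eventually_sequentiallyI[of 1])
    fix n :: nat
    assume n: "n \<ge> 1"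
    define h where "h = x\<^sub>0 / real n"
    have hp: "h > 0" using n assms(1) by (simp add: h_def)
    have "x\<^sub>0 * y\<^sub>0 * (g\<^sup>2 / 3 + g * ?d n + (?d n)\<^sup>2)
        = x\<^sub>0 * y\<^sub>0 * (g\<^sup>2 * h\<^sup>2 / 3 + g * (qh_op n - q_op) * h + (qh_op n - q_op)\<^sup>2) / h\<^sup>2"
      unfolding h_def[symmetric] using hp by (simp add: field_simps power2_eq_square)
    then show "sqrt (x\<^sub>0 * y\<^sub>0 * (g\<^sup>2 / 3 + g * ?d n + (?d n)\<^sup>2))
      = normH x\<^sub>0 y\<^sub>0 (\<lambda>p. partial_x (discrete_u x\<^sub>0 g b \<alpha> n (qh_op n)) p - partial_x (u q_op) p)
        / (x\<^sub>0 / real n)"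
      using hp normH_partial_x_error[where u = "u q_op" and q = q_op, OF assms(1,2) n h_def u]
      by (simp add: real_sqrt_divide flip: h_def)
  qed
  ultimately have b: "(\<lambda>n. normH x\<^sub>0 y\<^sub>0 (\<lambda>p. partial_x (discrete_u x\<^sub>0 g b \<alpha> n (qh_op n)) p
      - partial_x (u q_op) p) / (x\<^sub>0 / real n)) \<longlonglongrightarrow> ?C"
    by (rule Lim_transform_eventually)
  show ?thesis
    using linear_expansion_smallo[OF assms(1) a] linear_expansion_smallo[OF assms(1) b] by blast
qed

end
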